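(* Let $n\ge1$ be an integer. Then $$\sum_{\sigma\in\mathfrak{D}_n}p^{\mathrm{nest}\,\sigma}q^{\mathrm{cros}\,\sigma}t^{\mathrm{exc}\,\sigma}=\sum_{k=0}^{\lfloor n/2\rfloor}b_{n,k,0}(p,q)\,t^{k}(1+qt)^{n-2k}.$$
   Context: Let $\mathfrak{S}_n$ be the set of permutations $\sigma$ of $[n]=\{1,\dots,n\}$ and $\mathfrak{D}_n\subseteq\mathfrak{S}_n$ the set of derangements (permutations with $\sigma(i)\ne i$ for all $i$). For $\sigma\in\mathfrak{S}_n$ let $\mathrm{exc}\,\sigma=\#\{i\in[n]: i<\sigma(i)\}$; $\mathrm{drop}\,\sigma=\#\{i\in[n]: i>\sigma(i)\}$; $\mathrm{cros}\,\sigma=\#\{(i,j)\in[n]^2: (i<j\le\sigma(i)<\sigma(j))\text{ or }(i>j>\sigma(i)>\sigma(j))\}$; $\mathrm{nest}\,\sigma=\#\{(i,j)\in[n]^2: (i<j\le\sigma(j)<\sigma(i))\text{ or }(i>j>\sigma(j)>\sigma(i))\}$; $\mathrm{cda}\,\sigma=\#\{x:\sigma^{-1}(x)<x<\sigma(x)\}$; $\mathrm{cdd}\,\sigma=\#\{x:\sigma^{-1}(x)>x>\sigma(x)\}$; $\mathrm{cvalley}\,\sigma=\#\{x:\sigma^{-1}(x)>x<\sigma(x)\}$; $\mathrm{fix}\,\sigma=\#\{x:\sigma(x)=x\}$. Define $$B_n(p,q,t,u,v,w,y)=\sum_{\sigma\in\mathfrak{S}_n}p^{\mathrm{nest}\,\sigma}q^{\mathrm{cros}\,\sigma}t^{\mathrm{drop}\,\sigma}u^{\mathrm{cda}\,\sigma}v^{\mathrm{cdd}\,\sigma}w^{\mathrm{cvalley}\,\sigma}y^{\mathrm{fix}\,\sigma},$$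 and define $b_{n,k,j}(p,q)$ by $B_n(p,q,1,0,1,w,y)=\sum_{k,j\ge0}b_{n,k,j}(p,q)w^ky^j$ (with $0^0=1$). Equivalently, $b_{n,k,0}(p,q)=\sum_\sigma p^{\mathrm{nest}\,\sigma}q^{\mathrm{cros}\,\sigma}$ over all derangements $\sigma\in\mathfrak{D}_n$ with $\mathrm{cvalley}\,\sigma=k$ and $\mathrm{cda}\,\sigma=0$. *)

theory Defs
  imports "HOL-Combinatorics.Permutations" "HOL-Computational_Algebra.Polynomial"
begin

definition derangements :: "nat \<Rightarrow> (nat \<Rightarrow> nat) set" where
  "derangements n = {\<sigma>. \<sigma> permutes {1..n} \<and> (\<forall>i\<in>{1..n}. \<sigma> i \<noteq> i)}"

definition exc :: "nat \<Rightarrow> (nat \<Rightarrow> nat) \<Rightarrow> nat" where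
  "exc n \<sigma> = card {i \<in> {1..n}. i < \<sigma> i}"

definition drops :: "nat \<Rightarrow> (nat \<Rightarrow> nat) \<Rightarrow> nat" where
  "drops n \<sigma> = card {i \<in> {1..n}. i > \<sigma> i}"

definition cros :: "nat \<Rightarrow> (nat \<Rightarrow> nat) \<Rightarrow> nat" where
  "cros n \<sigma> = card {(i, j) \<in> {1..n} \<times> {1..n}.
     (i < j \<and> j \<le> \<sigma> i \<and> \<sigma> i < \<sigma> j) \<or> (i > j \<and> j > \<sigma> i \<and> \<sigma> i > \<sigma> j)}"

definition nest :: "nat \<Rightarrow> (nat \<Rightarrow> nat) \<Rightarrow> nat" where
  "nest n \<sigma> = card {(i, j) \<in> {1..n} \<times> {1..n}.
     (i < j \<and> j \<le> \<sigma> j \<and> \<sigma> j < \<sigma> i) \<or> (i > j \<and> j > \<sigma> j \<and> \<sigma> j > \<sigma> i)}"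

definition cda :: "nat \<Rightarrow> (nat \<Rightarrow> nat) \<Rightarrow> nat" where
  "cda n \<sigma> = card {x \<in> {1..n}. inv \<sigma> x < x \<and> x < \<sigma> x}"

definition cdd :: "nat \<Rightarrow> (nat \<Rightarrow> nat) \<Rightarrow> nat" where
  "cdd n \<sigma> = card {x \<in> {1..n}. inv \<sigma> x > x \<and> x > \<sigma> x}"

definition cvalley :: "nat \<Rightarrow> (nat \<Rightarrow> nat) \<Rightarrow> nat" where
  "cvalley n \<sigma> = card {x \<in> {1..n}. inv \<sigma> x > x \<and> x < \<sigma> x}"

definition fixp :: "nat \<Rightarrow> (nat \<Rightarrow> nat) \<Rightarrow> nat" where
  "fixp n \<sigma> = card {x \<in> {1..n}. \<sigma> x = x}"

definition B :: "nat \<Rightarrow> 'a \<Rightarrow> 'a \<Rightarrow> 'a \<Rightarrow> 'a \<Rightarrow> 'a \<Rightarrow> 'a \<Rightarrow> 'a \<Rightarrow> 'a::comm_ring_1" where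
  "B n p q t u v w y = (\<Sum>\<sigma> | \<sigma> permutes {1..n}.
     p ^ nest n \<sigma> * q ^ cros n \<sigma> * t ^ drops n \<sigma> * u ^ cda n \<sigma> * v ^ cdd n \<sigma>
       * w ^ cvalley n \<sigma> * y ^ fixp n \<sigma>)"

text \<open>
  The coefficient of \<open>w\<^sup>k y\<^sup>j\<close> in \<open>B n p q 1 0 1 w y\<close>, where \<open>w\<close> and \<open>y\<close> are
  indeterminates: \<open>B\<close> is evaluated in the ring \<open>R[w][y]\<close>, so the outer polynomial variable
  is \<open>y\<close> and the inner one is \<open>w\<close>.
\<close>

definition b :: "nat \<Rightarrow> nat \<Rightarrow> nat \<Rightarrow> 'a \<Rightarrow> 'a \<Rightarrow> 'a::comm_ring_1" where
  "b n k j p q = coeff (coeff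
     (B n [:[:p:]:] [:[:q:]:] 1 0 1 [:[:0, 1:]:] [:0, 1:]) j) k"

lemma b_altdef:
  "b n k j p q = (\<Sum>\<sigma> | \<sigma> permutes {1..n} \<and> cda n \<sigma> = 0 \<and> cvalley n \<sigma> = k \<and> fixp n \<sigma> = j.
     p ^ nest n \<sigma> * q ^ cros n \<sigma>)"
proof -
  have pC: "[:c:] ^ m = [:c ^ m:]" for c :: "'c::comm_ring_1" and m
    by (induction m) (simp_all add: mult.commute)
  have pX: "[:0, 1:] ^ m = monom (1::'c::comm_ring_1) m" for m
    by (simp add: monom_altdef)
  have "b n k j p q = (\<Sum>\<sigma> | \<sigma> permutes {1..n}.
      if cda n \<sigma> = 0 \<and> cvalley n \<sigma> = k \<and> fixp n \<sigma> = j
      then p ^ nest n \<sigma> * q ^ cros n \<sigma> else 0)"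
    unfolding b_def B_def coeff_sum
    by (intro sum.cong refl) (auto simp: pC pX power_0_left)
  also have "\<dots> = (\<Sum>\<sigma> \<in> {\<sigma> \<in> {\<sigma>. \<sigma> permutes {1..n}}.
      cda n \<sigma> = 0 \<and> cvalley n \<sigma> = k \<and> fixp n \<sigma> = j}. p ^ nest n \<sigma> * q ^ cros n \<sigma>)"
    by (rule sum.inter_filter[symmetric]) (simp add: finite_permutations)
  finally show ?thesis by simp
qed

end

theory Submission
  imports Defs
begin

text \<open>
  A derangement splits into its upper arcs \<open>(i, \<sigma> i)\<close> with \<open>i < \<sigma> i\<close> and its lower arcs
  \<open>(\<sigma> i, i)\<close> with \<open>\<sigma> i < i\<close>, two matchings of openers to larger closers. Apart from one crossing
  for each double ascent, \<open>nest\<close> and \<open>cros\<close> count nestings and crossings within each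
  matching. If a weight \<open>p\<close> is given to nestings and \<open>q\<close> to crossings, the matchings with
  given openers and closers have as total weight the product, over the closers \<open>c\<close>, of the
  \<open>(p, q)\<close>-analogue of the number of openers available at \<open>c\<close>. Turning a double
  descent into a double ascent moves one such factor from the lower to the upper product, and
  both matchings have the same number of available openers there, so it only contributes a
  factor \<open>q t\<close>. Each of the \<open>n - 2 k\<close> positions that are neither a valley nor a peak
  therefore yields a factor \<open>1 + q t\<close>.
\<close>

section \<open>Matchings, their nestings and crossings, and \<open>(p, q)\<close>-integers\<close>

text \<open>An arc is a pair (opener, closer). The sets \<open>X\<close> and \<open>Y\<close> may
  overlap: a common point closes one arc and opens another.\<close>

definition matchings :: "nat set \<Rightarrow> nat set \<Rightarrow> (nat \<times> nat) set set" where
  "matchings X Y = {M. bij_betw fst M X \<and> bij_betw snd M Y \<and> (\<forall>e\<in>M. fst e < snd e)}"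

definition nestings :: "(nat \<times> nat) set \<Rightarrow> ((nat \<times> nat) \<times> (nat \<times> nat)) set" where
  "nestings M = {(d, e) \<in> M \<times> M. fst d < fst e \<and> snd e < snd d}"

text \<open>Strictness of \<open>fst e < snd d\<close> excludes two arcs that merely meet in a
  point; \<open>cros\<close> treats such pairs differently above and below the diagonal.\<close>

definition crossings :: "(nat \<times> nat) set \<Rightarrow> ((nat \<times> nat) \<times> (nat \<times> nat)) set" where
  "crossings M = {(d, e) \<in> M \<times> M. fst d < fst e \<and> fst e < snd d \<and> snd d < snd e}"

definition matching_weight :: "'a \<Rightarrow> 'a \<Rightarrow> nat set \<Rightarrow> nat set \<Rightarrow> 'a::comm_ring_1" where
  "matching_weight p q X Y =
     (\<Sum>M\<in>matchings X Y. p ^ card (nestings M) * q ^ card (crossings M))"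

text \<open>This is \<open>(p ^ m - q ^ m) / (p - q)\<close>, written without division so that it
  makes sense in every commutative ring.\<close>

definition pq_nat :: "'a \<Rightarrow> 'a \<Rightarrow> nat \<Rightarrow> 'a::comm_ring_1" where
  "pq_nat p q m = (\<Sum>i<m. p ^ i * q ^ (m - 1 - i))"

lemma pq_nat_0 [simp]: "pq_nat p q 0 = 0"
  by (simp add: pq_nat_def)

lemma pq_nat_Suc: "pq_nat p q (Suc m) = q * pq_nat p q m + p ^ m"
proof -
  have "(\<Sum>i<m. p ^ i * q ^ (m - i)) = (\<Sum>i<m. q * (p ^ i * q ^ (m - 1 - i)))"
  proof (rule sum.cong[OF refl])
    fix i assume "i \<in> {..<m}"
    then have "m - i = Suc (m - 1 - i)" by auto
    then show "p ^ i * q ^ (m - i) = q * (p ^ i * q ^ (m - 1 - i))"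
      by (simp add: mult.left_commute)
  qed
  then show ?thesis by (simp add: pq_nat_def sum_distrib_left)
qed

text \<open>An element with \<open>i\<close> smaller elements has \<open>card S - 1 - i\<close>
  larger ones. In the induction a new maximum multiplies the old terms by \<open>q\<close> and adds
  a pure power of \<open>p\<close>, as in \<open>pq_nat_Suc\<close>.\<close>

lemma sum_rank_eq_pq_nat:
  fixes S :: "nat set" and p q :: "'a::comm_ring_1"
  assumes "finite S"
  shows "(\<Sum>a\<in>S. p ^ card {x\<in>S. x < a} * q ^ card {x\<in>S. a < x}) = pq_nat p q (card S)"
  using assms
proof (induction rule: finite_linorder_max_induct)
  case empty
  then show ?case by simp
next
  case (insert m A)
  have "m \<notin> A" using insert by auto
  have "{x \<in> insert m A. x < m} = A" "{x \<in> insert m A. m < x} = {}"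
    using insert by auto
  moreover have "p ^ card {x \<in> insert m A. x < a} * q ^ card {x \<in> insert m A. a < x}
      = q * (p ^ card {x\<in>A. x < a} * q ^ card {x\<in>A. a < x})" if "a \<in> A" for a
  proof -
    have "{x \<in> insert m A. x < a} = {x\<in>A. x < a}"
      "{x \<in> insert m A. a < x} = insert m {x\<in>A. a < x}"
      using insert that by (auto dest: less_asym)
    then show ?thesis
      using \<open>m \<notin> A\<close> \<open>finite A\<close> by (simp add: mult.left_commute)
  qed
  ultimately show ?case
    using insert \<open>m \<notin> A\<close>
    by (simp add: pq_nat_Suc sum_distrib_left[symmetric] add.commute del: Collect_empty_eq insert_iff)
qed

lemma matchings_arcD:
  assumes "M \<in> matchings X Y" "e \<in> M"
  shows "fst e \<in> X" "snd e \<in> Y" "fst e < snd e"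
  using assms imageI[of e M fst] imageI[of e M snd] by (simp_all add: matchings_def bij_betw_def)

lemma finite_matching: "M \<in> matchings X Y \<Longrightarrow> finite X \<Longrightarrow> finite M"
  by (auto simp: matchings_def bij_betw_finite)

lemma finite_matchings: "finite X \<Longrightarrow> finite Y \<Longrightarrow> finite (matchings X Y)"
proof -
  assume "finite X" "finite Y"
  moreover have "matchings X Y \<subseteq> Pow (X \<times> Y)"
    using matchings_arcD by (fastforce simp: mem_Times_iff)
  ultimately show ?thesis
    by (meson finite_Pow_iff finite_SigmaI finite_subset)
qed

lemma card_matching: "M \<in> matchings X Y \<Longrightarrow> card X = card Y"
  by (metis (mono_tags, lifting) bij_betw_same_card matchings_def mem_Collect_eq)

lemma matching_weight_eq_0: "card X \<noteq> card Y \<Longrightarrow> matching_weight p q X Y = 0"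
  using card_matching by (force simp: matching_weight_def intro!: sum.neutral)

text \<open>Each opener starts exactly one arc. This turns counts of arcs nesting with or crossing a
  given arc into counts of openers.\<close>

lemma card_matching_openers:
  assumes "M \<in> matchings X Y"
  shows "card {e\<in>M. P (fst e)} = card {x\<in>X. P x}"
proof -
  have "bij_betw fst {e\<in>M. P (fst e)} {x\<in>X. P x}"
  proof (rule bij_betw_subset)
    show "bij_betw fst M X" using assms by (simp add: matchings_def)
    then show "fst ` {e\<in>M. P (fst e)} = {x\<in>X. P x}" by (auto simp: bij_betw_def)
  qed auto
  then show ?thesis by (rule bij_betw_same_card)
qed

section \<open>Removing the arc at one closer, and the product formula for matchings\<close>

lemma insert_arc_matchings:
  assumes "M \<in> matchings (X - {a}) (Y - {c})" "a \<in> X" "c \<in> Y" "a < c"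
  shows "insert (a, c) M \<in> matchings X Y" "(a, c) \<notin> M"
proof -
  have M: "bij_betw fst M (X - {a})" "bij_betw snd M (Y - {c})" "\<forall>e\<in>M. fst e < snd e"
    using assms(1) by (auto simp: matchings_def)
  show notin: "(a, c) \<notin> M" using matchings_arcD[OF assms(1)] by force
  have "bij_betw fst (insert (a, c) M) (insert a (X - {a}))"
    using M(1) notin notIn_Un_bij_betw[of "(a, c)" M fst "X - {a}"] by simp
  moreover have "bij_betw snd (insert (a, c) M) (insert c (Y - {c}))"
    using M(2) notin notIn_Un_bij_betw[of "(a, c)" M snd "Y - {c}"] by simp
  ultimately show "insert (a, c) M \<in> matchings X Y"
    using M(3) assms(2-4) by (auto simp: matchings_def insert_absorb)
qed

lemma remove_arc_matchings:
  assumes "M \<in> matchings X Y" "(a, c) \<in> M"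
  shows "M - {(a, c)} \<in> matchings (X - {a}) (Y - {c})"
proof -
  have M: "bij_betw fst M X" "bij_betw snd M Y" "\<forall>e\<in>M. fst e < snd e"
    using assms(1) by (auto simp: matchings_def)
  have "a \<in> X" "c \<in> Y" using matchings_arcD[OF assms] by auto
  then have "bij_betw fst (M - {(a, c)}) (X - {a})" "bij_betw snd (M - {(a, c)}) (Y - {c})"
    using assms(2) by (auto intro!: bij_betw_DiffI M(1,2))
  then show ?thesis using M(3) by (simp add: matchings_def)
qed

text \<open>Exactly one arc ends at \<open>c\<close>. Its opener \<open>a\<close> can be any opener
  before \<open>c\<close>, and the other arcs form an arbitrary matching of what remains.\<close>

lemma sum_matchings_remove_closer:
  assumes "finite X" "finite Y" "c \<in> Y"
  shows "(\<Sum>M\<in>matchings X Y. g M)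
    = (\<Sum>a | a \<in> X \<and> a < c. \<Sum>M\<in>matchings (X - {a}) (Y - {c}). g (insert (a, c) M))"
proof -
  let ?I = "SIGMA a:{a \<in> X. a < c}. matchings (X - {a}) (Y - {c})"
  let ?f = "\<lambda>(a, M). insert (a, c) M"
  have inj: "inj_on ?f ?I"
  proof (rule inj_onI, clarify)
    fix a M a' M'
    assume *: "M \<in> matchings (X - {a}) (Y - {c})" "M' \<in> matchings (X - {a'}) (Y - {c})"
      "insert (a, c) M = insert (a', c) M'"
    have notin: "(x, c) \<notin> M" "(x, c) \<notin> M'" for x
      using *(1,2)[THEN matchings_arcD(2)] by force+
    moreover have "a = a'" using *(3) notin by blast
    ultimately show "a = a' \<and> M = M'" using *(3) insert_ident by metis
  qed
  have img: "?f ` ?I = matchings X Y"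
  proof (intro equalityI subsetI)
    fix M assume "M \<in> ?f ` ?I"
    then show "M \<in> matchings X Y" using assms insert_arc_matchings by auto
  next
    fix M assume M: "M \<in> matchings X Y"
    then obtain a where a: "(a, c) \<in> M"
      using assms(3) by (force simp: matchings_def bij_betw_def)
    have "a \<in> X" "a < c" using matchings_arcD[OF M a] by auto
    then have "(a, M - {(a, c)}) \<in> ?I"
      using remove_arc_matchings[OF M a] by auto
    moreover have "M = ?f (a, M - {(a, c)})" using a by auto
    ultimately show "M \<in> ?f ` ?I" by blast
  qed
  have "(\<Sum>M\<in>matchings X Y. g M) = (\<Sum>z\<in>?I. g (?f z))"
    unfolding img[symmetric] using inj by (simp add: sum.reindex)
  also have "\<dots> = (\<Sum>(a, M)\<in>?I. g (insert (a, c) M))"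
    by (intro sum.cong) auto
  also have "\<dots> = (\<Sum>a | a \<in> X \<and> a < c. \<Sum>M\<in>matchings (X - {a}) (Y - {c}). g (insert (a, c) M))"
    using assms finite_matchings by (subst sum.Sigma) auto
  finally show ?thesis .
qed

text \<open>As \<open>c\<close> is the least closer, \<open>(a, c)\<close> encloses no arc, and it
  lies inside exactly the arcs that open before \<open>a\<close>.\<close>

lemma card_nestings_insert:
  assumes "M \<in> matchings (X - {a}) (Y - {c})" "finite X" "a \<in> X" "a < c" "\<And>y. y \<in> Y \<Longrightarrow> c \<le> y"
  shows "card (nestings (insert (a, c) M)) = card {x\<in>X. x < a} + card (nestings M)"
proof -
  let ?S = "{e\<in>M. fst e < a}"
  have fin: "finite M" using assms finite_matching by blast
  have ends: "fst e \<noteq> a" "c < snd e" if "e \<in> M" for e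
    using matchings_arcD[OF assms(1) that] assms(5)[of "snd e"] by auto
  have "nestings (insert (a, c) M) = (\<lambda>e. (e, (a, c))) ` ?S \<union> nestings M"
    using ends by (fastforce simp: nestings_def)
  moreover have "(\<lambda>e. (e, (a, c))) ` ?S \<inter> nestings M = {}"
    using ends by (fastforce simp: nestings_def)
  moreover have "finite (nestings M)"
    by (rule finite_subset[of _ "M \<times> M"]) (auto simp: nestings_def fin)
  moreover have "card ((\<lambda>e. (e, (a, c))) ` ?S) = card ?S"
    by (intro card_image inj_onI) auto
  moreover have "card ?S = card {x\<in>X. x < a}"
    using card_matching_openers[OF assms(1), of "\<lambda>x. x < a"]
    by (auto intro: arg_cong[where f = card])
  ultimately show ?thesis using fin by (simp add: card_Un_disjoint)
qed

text \<open>As \<open>(a, c)\<close> closes first, it can only be the left arc of a crossing; its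
  partners are the arcs that open between \<open>a\<close> and \<open>c\<close>.\<close>

lemma card_crossings_insert:
  assumes "M \<in> matchings (X - {a}) (Y - {c})" "finite X" "a \<in> X" "a < c" "\<And>y. y \<in> Y \<Longrightarrow> c \<le> y"
  shows "card (crossings (insert (a, c) M)) = card {x\<in>X. a < x \<and> x < c} + card (crossings M)"
proof -
  let ?S = "{e\<in>M. a < fst e \<and> fst e < c}"
  have fin: "finite M" using assms finite_matching by blast
  have ends: "fst e \<noteq> a" "c < snd e" if "e \<in> M" for e
    using matchings_arcD[OF assms(1) that] assms(5)[of "snd e"] by auto
  have "crossings (insert (a, c) M) = (\<lambda>e. ((a, c), e)) ` ?S \<union> crossings M"
    using ends by (fastforce simp: crossings_def)
  moreover have "(\<lambda>e. ((a, c), e)) ` ?S \<inter> crossings M = {}"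
    using ends by (fastforce simp: crossings_def)
  moreover have "finite (crossings M)"
    by (rule finite_subset[of _ "M \<times> M"]) (auto simp: crossings_def fin)
  moreover have "card ((\<lambda>e. ((a, c), e)) ` ?S) = card ?S"
    by (intro card_image inj_onI) auto
  moreover have "card ?S = card {x\<in>X. a < x \<and> x < c}"
    using card_matching_openers[OF assms(1), of "\<lambda>x. a < x \<and> x < c"]
    by (auto intro: arg_cong[where f = card])
  ultimately show ?thesis using fin by (simp add: card_Un_disjoint)
qed

text \<open>
  The truncated subtraction is harmless below: if fewer openers than closers precede \<open>c\<close>, there
  is no matching, and the height \<open>0\<close> gives the factor \<open>pq_nat p q 0 = 0\<close>.
\<close>

definition height :: "nat set \<Rightarrow> nat set \<Rightarrow> nat \<Rightarrow> nat" where
  "height X Y c = card {x\<in>X. x < c} - card {y\<in>Y. y < c}"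

text \<open>Closers are served from left to right. The least closer \<open>c\<close> picks an opener
  \<open>a\<close> before it, at the cost of one \<open>p\<close> for each available opener left of
  \<open>a\<close> and one \<open>q\<close> for each right of it; summed over \<open>a\<close> this
  is a \<open>pq_nat\<close>. The set \<open>X\<close> varies in the induction since
  \<open>a\<close> is used up.\<close>

lemma matching_weight_eq_prod:
  assumes "finite Y" "finite X" "card X = card Y"
  shows "matching_weight p q X Y = (\<Prod>c\<in>Y. pq_nat p q (height X Y c))"
  using assms
proof (induction arbitrary: X rule: finite_linorder_min_induct)
  case empty
  then have "matchings X {} = {{}}" by (auto simp: matchings_def bij_betw_def)
  then show ?case by (simp add: matching_weight_def nestings_def crossings_def)
next
  case (insert c Z)
  let ?S = "{a\<in>X. a < c}" and ?Y = "insert c Z"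
  let ?P = "\<Prod>y\<in>Z. pq_nat p q (height X ?Y y)"
  have "c \<notin> Z" using insert by auto
  have ge: "c \<le> y" if "y \<in> ?Y" for y using that insert by auto
  have step: "(\<Sum>M\<in>matchings (X - {a}) (?Y - {c}).
        p ^ card (nestings (insert (a, c) M)) * q ^ card (crossings (insert (a, c) M)))
      = p ^ card {x\<in>?S. x < a} * q ^ card {x\<in>?S. a < x} * ?P" if a: "a \<in> ?S" for a
  proof -
    \<comment> \<open>Both \<open>a\<close> and \<open>c\<close> precede a later closer
      \<open>y\<close>, so both counts in \<open>height\<close> drop by one.\<close>
    have "height (X - {a}) Z y = height X ?Y y" if y: "y \<in> Z" for y
    proof -
      have "c < y" using insert y by auto
      have "{x\<in>X. x < y} = insert a {x\<in>X - {a}. x < y}"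
        "{x\<in>?Y. x < y} = insert c {x\<in>Z. x < y}"
        using a \<open>c < y\<close> by auto
      then show ?thesis
        using insert.prems insert.hyps(1) \<open>c \<notin> Z\<close> by (simp add: height_def)
    qed
    moreover have "card (X - {a}) = card Z"
      using insert.prems insert.hyps(1) \<open>c \<notin> Z\<close> a by simp
    ultimately have IH: "matching_weight p q (X - {a}) Z = ?P"
      using insert.IH[of "X - {a}"] insert.prems by simp
    have sets: "{x\<in>X. x < a} = {x\<in>?S. x < a}" "{x\<in>X. a < x \<and> x < c} = {x\<in>?S. a < x}"
      using a by auto
    have "(\<Sum>M\<in>matchings (X - {a}) (?Y - {c}).
        p ^ card (nestings (insert (a, c) M)) * q ^ card (crossings (insert (a, c) M)))
      = (\<Sum>M\<in>matchings (X - {a}) (?Y - {c}). p ^ card {x\<in>?S. x < a} * q ^ card {x\<in>?S. a < x}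
          * (p ^ card (nestings M) * q ^ card (crossings M)))"
    proof (rule sum.cong[OF refl])
      fix M assume M: "M \<in> matchings (X - {a}) (?Y - {c})"
      have "card (nestings (insert (a, c) M)) = card {x\<in>?S. x < a} + card (nestings M)"
        "card (crossings (insert (a, c) M)) = card {x\<in>?S. a < x} + card (crossings M)"
        using card_nestings_insert[OF M] card_crossings_insert[OF M] insert.prems a ge
        unfolding sets by auto
      then show "p ^ card (nestings (insert (a, c) M)) * q ^ card (crossings (insert (a, c) M))
        = p ^ card {x\<in>?S. x < a} * q ^ card {x\<in>?S. a < x}
          * (p ^ card (nestings M) * q ^ card (crossings M))"
        by (simp only: power_add) (simp only: mult_ac)
    qed
    also have "\<dots> = p ^ card {x\<in>?S. x < a} * q ^ card {x\<in>?S. a < x}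
        * matching_weight p q (X - {a}) Z"
      using \<open>c \<notin> Z\<close> by (simp add: matching_weight_def sum_distrib_left)
    finally show ?thesis unfolding IH .
  qed
  have "matching_weight p q X ?Y
      = (\<Sum>a\<in>?S. p ^ card {x\<in>?S. x < a} * q ^ card {x\<in>?S. a < x} * ?P)"
    unfolding matching_weight_def
    using insert.prems insert.hyps(1)
    by (subst sum_matchings_remove_closer[of _ _ c]) (auto intro!: sum.cong[OF refl] step[simplified])
  also have "\<dots> = pq_nat p q (card ?S) * ?P"
    unfolding sum_distrib_right[symmetric] using insert.prems by (subst sum_rank_eq_pq_nat) simp_all
  \<comment> \<open>No closer precedes the minimum \<open>c\<close>, so all openers before it are
    still available.\<close>
  also have "card ?S = height X ?Y c"
  proof -
    have "{y\<in>?Y. y < c} = {}" using ge by (auto simp: not_less)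
    then show ?thesis by (simp only: height_def card.empty diff_zero)
  qed
  finally show ?case using insert.hyps(1) \<open>c \<notin> Z\<close> by simp
qed

text \<open>A point that is both opener and closer raises both counts in \<open>height\<close>
  equally, so all heights stay those of \<open>X\<close> and \<open>Y\<close>, and \<open>A\<close>
  only adds its own factors to the product.\<close>

lemma matching_weight_Un:
  fixes p q :: "'a::comm_ring_1"
  assumes "finite X" "finite Y" "finite A" "A \<inter> X = {}" "A \<inter> Y = {}" "card X = card Y"
  shows "matching_weight p q (X \<union> A) (Y \<union> A)
    = matching_weight p q X Y * (\<Prod>c\<in>A. pq_nat p q (height X Y c))"
proof -
  have "height (X \<union> A) (Y \<union> A) c = height X Y c" for c
  proof -
    have "{x \<in> Z \<union> A. x < c} = {x\<in>Z. x < c} \<union> {x\<in>A. x < c}" for Z by auto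
    moreover have "{x\<in>X. x < c} \<inter> {x\<in>A. x < c} = {}" "{x\<in>Y. x < c} \<inter> {x\<in>A. x < c} = {}"
      using assms by auto
    ultimately show ?thesis using assms by (simp add: height_def card_Un_disjoint)
  qed
  moreover have "card (X \<union> A) = card (Y \<union> A)"
    using assms by (simp add: card_Un_disjoint Int_commute)
  ultimately show ?thesis
    using assms by (simp add: matching_weight_eq_prod prod.union_disjoint Int_commute)
qed

section \<open>Derangements as pairs of matchings\<close>

text \<open>The openers of the upper arcs; \<open>exc_image\<close> holds their closers. In a
  derangement the valleys lie in \<open>exc_set\<close> only, the peaks in \<open>exc_image\<close>
  only, the double ascents in both and the double descents in neither.\<close>

definition exc_set :: "nat \<Rightarrow> (nat \<Rightarrow> nat) \<Rightarrow> nat set" where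
  "exc_set n \<sigma> = {x\<in>{1..n}. x < \<sigma> x}"

definition exc_image :: "nat \<Rightarrow> (nat \<Rightarrow> nat) \<Rightarrow> nat set" where
  "exc_image n \<sigma> = {x\<in>{1..n}. inv \<sigma> x < x}"

definition upper_arcs :: "nat \<Rightarrow> (nat \<Rightarrow> nat) \<Rightarrow> (nat \<times> nat) set" where
  "upper_arcs n \<sigma> = (\<lambda>i. (i, \<sigma> i)) ` {i\<in>{1..n}. i < \<sigma> i}"

text \<open>Arcs are stored as (value, position), so that they too run from the smaller to the
  larger point.\<close>

definition lower_arcs :: "nat \<Rightarrow> (nat \<Rightarrow> nat) \<Rightarrow> (nat \<times> nat) set" where
  "lower_arcs n \<sigma> = (\<lambda>i. (\<sigma> i, i)) ` {i\<in>{1..n}. \<sigma> i < i}"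

text \<open>Serves to rebuild a derangement from its arcs: \<open>x\<close> is sent to the second
  entry of the only pair that starts with \<open>x\<close>, and points outside \<open>N\<close> are
  fixed.\<close>

lemma permutes_of_graph:
  assumes "bij_betw fst R N" "bij_betw snd R N"
  obtains \<sigma> where "\<sigma> permutes N" "R = (\<lambda>x. (x, \<sigma> x)) ` N"
proof -
  define g where "g = inv_into R fst"
  define \<sigma> where "\<sigma> = (\<lambda>x. if x \<in> N then snd (g x) else x)"
  have g: "bij_betw g N R" unfolding g_def by (rule bij_betw_inv_into[OF assms(1)])
  have fg: "fst (g x) = x" if "x \<in> N" for x
    using that assms(1) unfolding g_def by (metis bij_betw_inv_into_right)
  have "bij_betw (snd \<circ> g) N N" using g assms(2) by (rule bij_betw_trans)
  then have "bij_betw \<sigma> N N" by (rule bij_betw_cong[THEN iffD1, rotated]) (simp add: \<sigma>_def)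
  then have "\<sigma> permutes N" by (rule bij_imp_permutes) (simp add: \<sigma>_def)
  moreover have "(\<lambda>x. (x, \<sigma> x)) ` N = g ` N"
    using fg by (intro image_cong refl) (auto simp: \<sigma>_def prod_eq_iff)
  ultimately show ?thesis using that g by (simp add: bij_betw_def)
qed

lemma upper_arcs_in_matchings:
  assumes "\<sigma> permutes {1..n}"
  shows "upper_arcs n \<sigma> \<in> matchings (exc_set n \<sigma>) (exc_image n \<sigma>)"
proof -
  have "inj \<sigma>" using assms by (rule permutes_inj)
  have "bij_betw fst (upper_arcs n \<sigma>) (exc_set n \<sigma>)"
    by (auto simp: bij_betw_def inj_on_def upper_arcs_def exc_set_def image_image)
  moreover have "snd ` upper_arcs n \<sigma> = exc_image n \<sigma>"
  proof (intro equalityI subsetI)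
    fix x assume "x \<in> exc_image n \<sigma>"
    then have "x = \<sigma> (inv \<sigma> x)" "inv \<sigma> x \<in> {i\<in>{1..n}. i < \<sigma> i}"
      using permutes_inverses(1)[OF assms] permutes_in_image[OF permutes_inv[OF assms], of x]
      by (auto simp: exc_image_def)
    then show "x \<in> snd ` upper_arcs n \<sigma>"
      by (auto simp: upper_arcs_def image_image intro: image_eqI)
  next
    fix x assume "x \<in> snd ` upper_arcs n \<sigma>"
    then obtain i where "i \<in> {1..n}" "i < \<sigma> i" "x = \<sigma> i" by (auto simp: upper_arcs_def)
    then show "x \<in> exc_image n \<sigma>"
      using permutes_inverses(2)[OF assms] permutes_in_image[OF assms, of i]
      by (auto simp: exc_image_def)
  qed
  moreover have "inj_on snd (upper_arcs n \<sigma>)"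
    using \<open>inj \<sigma>\<close> by (auto simp: upper_arcs_def inj_on_def)
  ultimately show ?thesis by (auto simp: matchings_def bij_betw_def upper_arcs_def)
qed

lemma derangement_permutes: "\<sigma> \<in> derangements n \<Longrightarrow> \<sigma> permutes {1..n}"
  by (simp add: derangements_def)

lemma derangement_neq:
  assumes "\<sigma> \<in> derangements n" "x \<in> {1..n}"
  shows "\<sigma> x \<noteq> x" "inv \<sigma> x \<noteq> x"
proof -
  show "\<sigma> x \<noteq> x" using assms by (simp add: derangements_def)
  then show "inv \<sigma> x \<noteq> x"
    using permutes_inverses(1)[OF derangement_permutes[OF assms(1)]] by metis
qed

text \<open>Without fixed points every position that is not an excedance is a drop, and every value
  that is not the image of an excedance is the image of a drop. A lower arc opens at its value and
  closes at its position, hence the two complements appear in exchanged roles.\<close>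

lemma lower_arcs_in_matchings:
  assumes "\<sigma> \<in> derangements n"
  shows "lower_arcs n \<sigma> \<in> matchings ({1..n} - exc_image n \<sigma>) ({1..n} - exc_set n \<sigma>)"
proof -
  note perm = derangement_permutes[OF assms]
  have "inj \<sigma>" using perm by (rule permutes_inj)
  have "{i \<in> {1..n}. \<sigma> i < i} = {1..n} - exc_set n \<sigma>"
    using derangement_neq(1)[OF assms] by (force simp: exc_set_def)
  then have "bij_betw snd (lower_arcs n \<sigma>) ({1..n} - exc_set n \<sigma>)"
    by (auto simp: bij_betw_def inj_on_def lower_arcs_def image_image)
  moreover have "fst ` lower_arcs n \<sigma> = {1..n} - exc_image n \<sigma>"
  proof (intro equalityI subsetI)
    fix x assume x: "x \<in> {1..n} - exc_image n \<sigma>"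
    then have "inv \<sigma> x > x" using derangement_neq(2)[OF assms, of x]
      by (auto simp: exc_image_def)
    then have "x = \<sigma> (inv \<sigma> x)" "inv \<sigma> x \<in> {i\<in>{1..n}. \<sigma> i < i}"
      using x permutes_inverses(1)[OF perm] permutes_in_image[OF permutes_inv[OF perm], of x]
      by auto
    then show "x \<in> fst ` lower_arcs n \<sigma>"
      by (auto simp: lower_arcs_def image_image intro: image_eqI)
  next
    fix x assume "x \<in> fst ` lower_arcs n \<sigma>"
    then obtain i where "i \<in> {1..n}" "\<sigma> i < i" "x = \<sigma> i" by (auto simp: lower_arcs_def)
    then show "x \<in> {1..n} - exc_image n \<sigma>"
      using permutes_inverses(2)[OF perm] permutes_in_image[OF perm, of i]
      by (auto simp: exc_image_def)
  qed
  moreover have "inj_on fst (lower_arcs n \<sigma>)"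
    using \<open>inj \<sigma>\<close> by (auto simp: lower_arcs_def inj_on_def)
  ultimately show ?thesis by (auto simp: matchings_def bij_betw_def lower_arcs_def)
qed

text \<open>Without fixed points the weak inequality in \<open>nest\<close> is strict, and its two
  cases are the nestings among upper and among lower arcs.\<close>

lemma nest_eq:
  assumes "\<sigma> \<in> derangements n"
  shows "nest n \<sigma> = card (nestings (upper_arcs n \<sigma>)) + card (nestings (lower_arcs n \<sigma>))"
proof -
  let ?I = "{1..n} \<times> {1..n}"
  let ?U = "{(i, j) \<in> ?I. i < j \<and> j < \<sigma> j \<and> \<sigma> j < \<sigma> i}"
  let ?L = "{(i, j) \<in> ?I. i > j \<and> j > \<sigma> j \<and> \<sigma> j > \<sigma> i}"
  have fin: "finite ?U" "finite ?L" by (rule finite_subset[of _ ?I]; force)+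
  have le: "j \<le> \<sigma> j \<longleftrightarrow> j < \<sigma> j" if "j \<in> {1..n}" for j
    using derangement_neq(1)[OF assms that] by auto
  have "{(i, j) \<in> ?I. (i < j \<and> j \<le> \<sigma> j \<and> \<sigma> j < \<sigma> i) \<or> (i > j \<and> j > \<sigma> j \<and> \<sigma> j > \<sigma> i)}
    = ?U \<union> ?L"
    using le by auto
  then have "nest n \<sigma> = card (?U \<union> ?L)"
    by (simp only: nest_def)
  also have "\<dots> = card ?U + card ?L"
    using fin by (intro card_Un_disjoint) auto
  finally have "nest n \<sigma> = card ?U + card ?L" .
  moreover have "nestings (upper_arcs n \<sigma>) = (\<lambda>(i, j). ((i, \<sigma> i), (j, \<sigma> j))) ` ?U"
    by (auto simp: nestings_def upper_arcs_def image_iff)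
  then have "card (nestings (upper_arcs n \<sigma>)) = card ?U"
    by (simp only:) (intro card_image inj_onI, auto)
  moreover have "nestings (lower_arcs n \<sigma>) = (\<lambda>(i, j). ((\<sigma> i, i), (\<sigma> j, j))) ` ?L"
    by (auto simp: nestings_def lower_arcs_def image_iff)
  then have "card (nestings (lower_arcs n \<sigma>)) = card ?L"
    by (simp only:) (intro card_image inj_onI, auto)
  ultimately show ?thesis by simp
qed

text \<open>The upper case of \<open>cros\<close> allows \<open>j = \<sigma> i\<close>, where two
  upper arcs meet in a double ascent \<open>j\<close>; the lower case is strict. This asymmetry is
  the source of the \<open>q\<close> in \<open>1 + q * t\<close>.\<close>

lemma cros_eq:
  assumes perm: "\<sigma> permutes {1..n}"
  shows "cros n \<sigma> = card (exc_set n \<sigma> \<inter> exc_image n \<sigma>)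
    + card (crossings (upper_arcs n \<sigma>)) + card (crossings (lower_arcs n \<sigma>))"
proof -
  let ?I = "{1..n} \<times> {1..n}"
  let ?U = "{(i, j) \<in> ?I. i < j \<and> j < \<sigma> i \<and> \<sigma> i < \<sigma> j}"
  let ?L = "{(i, j) \<in> ?I. i > j \<and> j > \<sigma> i \<and> \<sigma> i > \<sigma> j}"
  let ?T = "{(i, j) \<in> ?I. i < j \<and> j = \<sigma> i \<and> \<sigma> i < \<sigma> j}"
  have fin: "finite ?U" "finite ?L" "finite ?T" by (rule finite_subset[of _ ?I]; force)+
  have "{(i, j) \<in> ?I. (i < j \<and> j \<le> \<sigma> i \<and> \<sigma> i < \<sigma> j) \<or> (i > j \<and> j > \<sigma> i \<and> \<sigma> i > \<sigma> j)}
    = (?T \<union> ?U) \<union> ?L"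
    by (force simp: le_less)
  then have "cros n \<sigma> = card ((?T \<union> ?U) \<union> ?L)"
    by (simp only: cros_def)
  also have "\<dots> = card (?T \<union> ?U) + card ?L"
    using fin by (intro card_Un_disjoint) auto
  also have "card (?T \<union> ?U) = card ?T + card ?U"
    using fin by (intro card_Un_disjoint) auto
  finally have "cros n \<sigma> = card ?T + card ?U + card ?L" .
  \<comment> \<open>A double ascent \<open>j\<close> accounts for exactly one such pair, whose first
    entry is its preimage.\<close>
  moreover have "?T = (\<lambda>j. (inv \<sigma> j, j)) ` (exc_set n \<sigma> \<inter> exc_image n \<sigma>)"
  proof (intro equalityI subsetI)
    fix z assume "z \<in> ?T"
    then obtain i where "z = (i, \<sigma> i)" "i \<in> {1..n}" "\<sigma> i \<in> {1..n}" "i < \<sigma> i" "\<sigma> i < \<sigma> (\<sigma> i)"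
      by auto
    then show "z \<in> (\<lambda>j. (inv \<sigma> j, j)) ` (exc_set n \<sigma> \<inter> exc_image n \<sigma>)"
      using permutes_inverses(2)[OF perm]
      by (intro image_eqI[of _ _ "\<sigma> i"]) (auto simp: exc_set_def exc_image_def)
  next
    fix z assume "z \<in> (\<lambda>j. (inv \<sigma> j, j)) ` (exc_set n \<sigma> \<inter> exc_image n \<sigma>)"
    then obtain j where "z = (inv \<sigma> j, j)" "j \<in> {1..n}" "inv \<sigma> j < j" "j < \<sigma> j"
      by (auto simp: exc_set_def exc_image_def)
    then show "z \<in> ?T"
      using permutes_inverses(1)[OF perm] permutes_in_image[OF permutes_inv[OF perm], of j] by auto
  qed
  then have "card ?T = card (exc_set n \<sigma> \<inter> exc_image n \<sigma>)"
    by (simp only:) (intro card_image inj_onI, auto)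
  moreover have "crossings (upper_arcs n \<sigma>) = (\<lambda>(i, j). ((i, \<sigma> i), (j, \<sigma> j))) ` ?U"
    by (auto simp: crossings_def upper_arcs_def image_iff)
  then have "card (crossings (upper_arcs n \<sigma>)) = card ?U"
    by (simp only:) (intro card_image inj_onI, auto)
  \<comment> \<open>The order is exchanged: in \<open>?L\<close> the arc of \<open>j\<close> has the
    smaller opener, \<open>\<sigma> j\<close>.\<close>
  moreover have "crossings (lower_arcs n \<sigma>) = (\<lambda>(i, j). ((\<sigma> j, j), (\<sigma> i, i))) ` ?L"
    by (auto simp: crossings_def lower_arcs_def image_iff)
  then have "card (crossings (lower_arcs n \<sigma>)) = card ?L"
    by (simp only:) (intro card_image inj_onI, auto)
  ultimately show ?thesis by simp
qed

text \<open>Every point starts an upper arc or ends a lower one, so the arcs determine the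
  derangement. Conversely, the positions and the values of the two matchings are complementary, so
  any two matchings combine into the graph of a permutation.\<close>

lemma bij_betw_derangements_matchings:
  assumes "E \<subseteq> {1..n}" "F \<subseteq> {1..n}"
  shows "bij_betw (\<lambda>\<sigma>. (upper_arcs n \<sigma>, lower_arcs n \<sigma>))
    {\<sigma> \<in> derangements n. exc_set n \<sigma> = E \<and> exc_image n \<sigma> = F}
    (matchings E F \<times> matchings ({1..n} - F) ({1..n} - E))" (is "bij_betw ?f ?D ?M")
proof (rule bij_betw_imageI)
  show "inj_on ?f ?D"
  proof (rule inj_onI, rule ext)
    fix \<sigma> \<tau> x assume *: "\<sigma> \<in> ?D" "\<tau> \<in> ?D" "?f \<sigma> = ?f \<tau>"
    then have perm: "\<sigma> permutes {1..n}" "\<tau> permutes {1..n}"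
      using derangement_permutes by blast+
    show "\<sigma> x = \<tau> x"
    proof (cases "x \<in> {1..n}")
      case False
      then show ?thesis using perm by (simp add: permutes_not_in)
    next
      case True
      then consider "x < \<sigma> x" | "\<sigma> x < x"
        using derangement_neq(1)[of \<sigma> n x] * by (auto simp: neq_iff)
      then show ?thesis
      proof cases
        case 1
        then have "(x, \<sigma> x) \<in> upper_arcs n \<sigma>" using True by (auto simp: upper_arcs_def)
        then have "(x, \<sigma> x) \<in> upper_arcs n \<tau>" using *(3) by simp
        then show ?thesis by (auto simp: upper_arcs_def)
      next
        case 2
        then have "(\<sigma> x, x) \<in> lower_arcs n \<sigma>" using True by (auto simp: lower_arcs_def)
        then have "(\<sigma> x, x) \<in> lower_arcs n \<tau>" using *(3) by simp
        then show ?thesis by (auto simp: lower_arcs_def)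
      qed
    qed
  qed
  show "?f ` ?D = ?M"
  proof (intro equalityI subsetI)
    fix z assume "z \<in> ?f ` ?D"
    then show "z \<in> ?M"
      using upper_arcs_in_matchings lower_arcs_in_matchings derangement_permutes by fastforce
  next
    fix z assume "z \<in> ?M"
    then obtain U L where z: "z = (U, L)" and U: "U \<in> matchings E F"
      and L: "L \<in> matchings ({1..n} - F) ({1..n} - E)" by auto
    \<comment> \<open>The intended graph: swapping turns a lower arc back into (position,
      value).\<close>
    define R where "R = U \<union> prod.swap ` L"
    have "bij_betw fst (prod.swap ` L) ({1..n} - E)" "bij_betw snd (prod.swap ` L) ({1..n} - F)"
      using L by (auto simp: matchings_def bij_betw_def inj_on_def image_image)
    moreover have "bij_betw fst U E" "bij_betw snd U F" using U by (auto simp: matchings_def)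
    ultimately have "bij_betw fst R (E \<union> ({1..n} - E))" "bij_betw snd R (F \<union> ({1..n} - F))"
      unfolding R_def by (simp_all only: bij_betw_combine Diff_disjoint)
    then have "bij_betw fst R {1..n}" "bij_betw snd R {1..n}"
      using assms by (simp_all add: Un_absorb1)
    then obtain \<sigma> where \<sigma>: "\<sigma> permutes {1..n}" and R: "R = (\<lambda>x. (x, \<sigma> x)) ` {1..n}"
      by (rule permutes_of_graph)
    have less: "fst e < snd e" if "e \<in> U \<or> e \<in> L" for e
      using that U L by (auto simp: matchings_def)
    \<comment> \<open>Pairs from \<open>U\<close> increase and swapped pairs from \<open>L\<close>
      decrease, so comparing the entries recovers \<open>U\<close> and \<open>L\<close> from
      \<open>R\<close> and rules out fixed points.\<close>
    have "upper_arcs n \<sigma> = {e \<in> R. fst e < snd e}" unfolding R upper_arcs_def by auto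
    also have "\<dots> = U" unfolding R_def using less by (force dest: less_asym)
    finally have up: "upper_arcs n \<sigma> = U" .
    have "lower_arcs n \<sigma> = prod.swap ` {e \<in> R. snd e < fst e}"
      unfolding R lower_arcs_def by (auto simp: image_iff)
    also have "{e \<in> R. snd e < fst e} = prod.swap ` L"
      unfolding R_def using less by (force dest: less_asym)
    also have "prod.swap ` prod.swap ` L = L" by (simp add: image_image)
    finally have low: "lower_arcs n \<sigma> = L" .
    have "\<sigma> x \<noteq> x" if "x \<in> {1..n}" for x
    proof -
      have "(x, \<sigma> x) \<in> R" using that R by auto
      then show ?thesis using less by (force simp: R_def)
    qed
    then have "\<sigma> \<in> derangements n" using \<sigma> by (simp add: derangements_def)
    moreover have "exc_set n \<sigma> = E" "exc_image n \<sigma> = F"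
      using upper_arcs_in_matchings[OF \<sigma>] U unfolding up by (auto simp: matchings_def bij_betw_def)
    ultimately have "\<sigma> \<in> ?D" by simp
    then show "z \<in> ?f ` ?D" using z up low by (intro image_eqI[of _ _ \<sigma>]) simp_all
  qed
qed

lemma sum_derangements_by_type:
  fixes p q :: "'a::comm_ring_1"
  assumes "E \<subseteq> {1..n}" "F \<subseteq> {1..n}"
  shows "(\<Sum>\<sigma> | \<sigma> \<in> derangements n \<and> exc_set n \<sigma> = E \<and> exc_image n \<sigma> = F.
      p ^ nest n \<sigma> * q ^ cros n \<sigma>)
    = q ^ card (E \<inter> F) * (matching_weight p q E F * matching_weight p q ({1..n} - F) ({1..n} - E))"
proof -
  let ?D = "{\<sigma> \<in> derangements n. exc_set n \<sigma> = E \<and> exc_image n \<sigma> = F}"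
  let ?w = "\<lambda>M. p ^ card (nestings M) * q ^ card (crossings M)"
  have "(\<Sum>\<sigma>\<in>?D. p ^ nest n \<sigma> * q ^ cros n \<sigma>)
      = (\<Sum>\<sigma>\<in>?D. (\<lambda>(U, L). q ^ card (E \<inter> F) * (?w U * ?w L)) (upper_arcs n \<sigma>, lower_arcs n \<sigma>))"
    by (intro sum.cong refl)
      (auto simp: nest_eq cros_eq[OF derangement_permutes] power_add mult_ac)
  also have "\<dots> = (\<Sum>(U, L)\<in>matchings E F \<times> matchings ({1..n} - F) ({1..n} - E).
      q ^ card (E \<inter> F) * (?w U * ?w L))"
    by (rule sum.reindex_bij_betw[OF bij_betw_derangements_matchings[OF assms]])
  also have "\<dots> = q ^ card (E \<inter> F) * (matching_weight p q E F * matching_weight p q ({1..n} - F) ({1..n} - E))"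
    unfolding matching_weight_def sum_product sum.cartesian_product
    by (simp add: sum_distrib_left case_prod_unfold)
  finally show ?thesis by simp
qed

section \<open>Exchanging double descents for double ascents\<close>

text \<open>The total weight of the derangements with \<open>exc_set\<close> \<open>E\<close> and
  \<open>exc_image\<close> \<open>F\<close>, apart from the factor
  \<open>q ^ card (E \<inter> F)\<close> due to double ascents.\<close>

definition type_weight :: "nat \<Rightarrow> 'a \<Rightarrow> 'a \<Rightarrow> nat set \<Rightarrow> nat set \<Rightarrow> 'a::comm_ring_1" where
  "type_weight n p q E F = matching_weight p q E F * matching_weight p q ({1..n} - F) ({1..n} - E)"

text \<open>The double ascents \<open>A\<close> add factors to the upper product, the double
  descents to the lower one. Both use the heights of \<open>V\<close> and \<open>P\<close>, so the
  total product runs over the same points for every \<open>A\<close>.\<close>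

lemma type_weight_Un:
  fixes p q :: "'a::comm_ring_1"
  assumes "V \<subseteq> {1..n}" "P \<subseteq> {1..n}" "V \<inter> P = {}" "A \<subseteq> {1..n} - V - P" "card V = card P"
  shows "type_weight n p q (V \<union> A) (P \<union> A) = type_weight n p q V P"
proof -
  let ?D = "{1..n} - V - P"
  let ?\<pi> = "\<lambda>S. \<Prod>c\<in>S. pq_nat p q (height V P c)"
  have fin: "finite V" "finite P" "finite A" using assms by (auto intro: finite_subset)
  have Un: "matching_weight p q (V \<union> S) (P \<union> S) = matching_weight p q V P * ?\<pi> S"
    if "S \<subseteq> ?D" for S
    using that fin assms finite_subset[OF that] by (intro matching_weight_Un) auto
  \<comment> \<open>Valleys open and peaks close arcs in both matchings; the remaining points
    outside \<open>A\<close> do both in the lower one.\<close>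
  have "{1..n} - (P \<union> A) = V \<union> (?D - A)" "{1..n} - (V \<union> A) = P \<union> (?D - A)"
    "{1..n} - P = V \<union> ?D" "{1..n} - V = P \<union> ?D"
    using assms by auto
  then have "type_weight n p q (V \<union> A) (P \<union> A)
      = matching_weight p q V P * ?\<pi> A * (matching_weight p q V P * ?\<pi> (?D - A))"
    "type_weight n p q V P = matching_weight p q V P * (matching_weight p q V P * ?\<pi> ?D)"
    using Un[OF assms(4)] Un[of "?D - A"] Un[of ?D] by (simp_all add: type_weight_def)
  moreover have "?\<pi> ?D = ?\<pi> (?D - A) * ?\<pi> A" using assms(4) by (intro prod.subset_diff) auto
  ultimately show ?thesis by (simp add: mult_ac)
qed

text \<open>The function \<open>g\<close> stands for any statistic that depends only on the type: a
  power of \<open>t\<close> for the left side of the theorem, an indicator for the coefficients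
  \<open>b\<close>.\<close>

lemma sum_derangements:
  fixes p q :: "'a::comm_ring_1"
  shows "(\<Sum>\<sigma>\<in>derangements n. p ^ nest n \<sigma> * q ^ cros n \<sigma> * g (exc_set n \<sigma>) (exc_image n \<sigma>))
    = (\<Sum>(E, F)\<in>Pow {1..n} \<times> Pow {1..n}. q ^ card (E \<inter> F) * type_weight n p q E F * g E F)"
proof -
  let ?T = "Pow {1..n} \<times> Pow {1..n}"
  let ?h = "\<lambda>\<sigma>. (exc_set n \<sigma>, exc_image n \<sigma>)"
  have "finite (derangements n)"
    by (rule finite_subset[OF _ finite_permutations[of "{1..n}"]]) (auto simp: derangements_def)
  then have "(\<Sum>\<sigma>\<in>derangements n. p ^ nest n \<sigma> * q ^ cros n \<sigma> * g (exc_set n \<sigma>) (exc_image n \<sigma>))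
    = (\<Sum>z\<in>?T. \<Sum>\<sigma> | \<sigma> \<in> derangements n \<and> ?h \<sigma> = z.
        p ^ nest n \<sigma> * q ^ cros n \<sigma> * g (exc_set n \<sigma>) (exc_image n \<sigma>))"
    by (intro sum.group[symmetric]) (auto simp: exc_set_def exc_image_def)
  also have "\<dots> = (\<Sum>(E, F)\<in>?T. q ^ card (E \<inter> F) * type_weight n p q E F * g E F)"
  proof (intro sum.cong refl, clarify)
    fix E F assume "E \<subseteq> {1..n}" "F \<subseteq> {1..n}"
    note by_type = sum_derangements_by_type[OF this, where p = p and q = q]
    show "(\<Sum>\<sigma> | \<sigma> \<in> derangements n \<and> ?h \<sigma> = (E, F).
        p ^ nest n \<sigma> * q ^ cros n \<sigma> * g (exc_set n \<sigma>) (exc_image n \<sigma>))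
      = q ^ card (E \<inter> F) * type_weight n p q E F * g E F"
      unfolding type_weight_def by_type[symmetric] sum_distrib_right
      by (intro sum.cong) auto
  qed
  finally show ?thesis .
qed

section \<open>Types sorted by valleys and peaks, and the coefficients \<open>b\<close>\<close>

definition disjoint_pairs :: "nat \<Rightarrow> (nat set \<times> nat set) set" where
  "disjoint_pairs n = {(V, P). V \<subseteq> {1..n} \<and> P \<subseteq> {1..n} \<and> V \<inter> P = {}}"

lemma finite_disjoint_pairs: "finite (disjoint_pairs n)"
  by (rule finite_subset[of _ "Pow {1..n} \<times> Pow {1..n}"]) (auto simp: disjoint_pairs_def)

text \<open>A type is determined by its valleys \<open>E - F\<close>, its peaks \<open>F - E\<close>
  and its double ascents \<open>E \<inter> F\<close>, the last being any set of points disjoint from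
  the others.\<close>

lemma sum_pairs_split:
  fixes g :: "nat set \<Rightarrow> nat set \<Rightarrow> 'a::comm_monoid_add"
  shows "(\<Sum>(E, F)\<in>Pow {1..n} \<times> Pow {1..n}. g E F)
    = (\<Sum>(V, P)\<in>disjoint_pairs n. \<Sum>A\<in>Pow ({1..n} - V - P). g (V \<union> A) (P \<union> A))"
proof -
  have "(\<Sum>(V, P)\<in>disjoint_pairs n. \<Sum>A\<in>Pow ({1..n} - V - P). g (V \<union> A) (P \<union> A))
    = (\<Sum>(z, A)\<in>(SIGMA z:disjoint_pairs n. Pow ({1..n} - fst z - snd z)).
        g (fst z \<union> A) (snd z \<union> A))"
    by (subst sum.Sigma[symmetric]) (auto simp: finite_disjoint_pairs case_prod_unfold)
  also have "\<dots> = (\<Sum>(E, F)\<in>Pow {1..n} \<times> Pow {1..n}. g E F)"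
    by (rule sum.reindex_bij_witness[where
          i = "\<lambda>(E, F). ((E - F, F - E), E \<inter> F)" and j = "\<lambda>((V, P), A). (V \<union> A, P \<union> A)"])
      (auto simp: disjoint_pairs_def Un_Diff_Int)
  finally show ?thesis by simp
qed

lemma sum_Pow_power_card:
  fixes x :: "'a::comm_ring_1"
  assumes "finite S"
  shows "(\<Sum>A\<in>Pow S. x ^ card A) = (1 + x) ^ card S"
  using assms
proof (induction S)
  case empty
  then show ?case by simp
next
  case (insert s S)
  have "(\<Sum>A\<in>insert s ` Pow S. x ^ card A) = (\<Sum>A\<in>Pow S. x ^ card (insert s A))"
    using insert.hyps by (subst sum.reindex) (auto simp: inj_on_def)
  also have "\<dots> = (\<Sum>A\<in>Pow S. x * x ^ card A)"
    using insert.hyps by (intro sum.cong refl) (auto simp: card_insert_if finite_subset)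
  finally have "(\<Sum>A\<in>insert s ` Pow S. x ^ card A) = x * (1 + x) ^ card S"
    by (simp add: insert.IH sum_distrib_left[symmetric])
  moreover have "Pow S \<inter> insert s ` Pow S = {}" using insert.hyps by auto
  ultimately show ?case
    using insert by (simp add: Pow_insert sum.union_disjoint algebra_simps)
qed

lemma type_weight_eq_0: "card V \<noteq> card P \<Longrightarrow> type_weight n p q V P = 0"
  by (simp add: type_weight_def matching_weight_eq_0)

text \<open>Exponent \<open>0\<close> of \<open>y\<close> leaves the derangements, and
  \<open>cda n \<sigma> = 0\<close> makes \<open>exc_set\<close> and \<open>exc_image\<close>
  disjoint. Every excedance is then a valley, so \<open>cvalley\<close> counts all of
  \<open>exc_set\<close>.\<close>

lemma b_eq_type_weight:
  fixes p q :: "'a::comm_ring_1"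
  shows "b n k 0 p q = (\<Sum>(V, P) | (V, P) \<in> disjoint_pairs n \<and> card V = k. type_weight n p q V P)"
proof -
  let ?g = "\<lambda>E F. if E \<inter> F = {} \<and> card E = k then 1 else 0 :: 'a"
  have "b n k 0 p q = (\<Sum>\<sigma> | \<sigma> \<in> derangements n \<and> exc_set n \<sigma> \<inter> exc_image n \<sigma> = {} \<and>
      card (exc_set n \<sigma>) = k. p ^ nest n \<sigma> * q ^ cros n \<sigma>)"
    unfolding b_altdef
  proof (rule sum.cong[OF _ refl], rule Collect_cong)
    fix \<sigma> :: "nat \<Rightarrow> nat"
    have fixp: "fixp n \<sigma> = 0 \<longleftrightarrow> (\<forall>i\<in>{1..n}. \<sigma> i \<noteq> i)"
      by (auto simp: fixp_def)
    have "cda n \<sigma> = card (exc_set n \<sigma> \<inter> exc_image n \<sigma>)"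
      unfolding cda_def exc_set_def exc_image_def by (intro arg_cong[where f = card]) auto
    moreover have "finite (exc_set n \<sigma>)" by (simp add: exc_set_def)
    ultimately have cda: "cda n \<sigma> = 0 \<longleftrightarrow> exc_set n \<sigma> \<inter> exc_image n \<sigma> = {}"
      by simp
    have valley: "cvalley n \<sigma> = card (exc_set n \<sigma>)"
      if "\<sigma> \<in> derangements n" "exc_set n \<sigma> \<inter> exc_image n \<sigma> = {}"
    proof -
      \<comment> \<open>An excedance outside \<open>exc_image\<close> has a larger preimage, as its
        preimage is not itself.\<close>
      have "{x \<in> {1..n}. inv \<sigma> x > x \<and> x < \<sigma> x} = exc_set n \<sigma>"
        using that derangement_neq(2)[OF that(1)]
        by (auto simp: exc_set_def exc_image_def disjoint_iff) (metis atLeastAtMost_iff One_nat_def neq_iff)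
      then show ?thesis by (simp add: cvalley_def)
    qed
    show "(\<sigma> permutes {1..n} \<and> cda n \<sigma> = 0 \<and> cvalley n \<sigma> = k \<and> fixp n \<sigma> = 0)
      = (\<sigma> \<in> derangements n \<and> exc_set n \<sigma> \<inter> exc_image n \<sigma> = {} \<and> card (exc_set n \<sigma>) = k)"
      using valley unfolding cda fixp derangements_def by auto
  qed
  also have "\<dots> = (\<Sum>\<sigma>\<in>derangements n. p ^ nest n \<sigma> * q ^ cros n \<sigma> * ?g (exc_set n \<sigma>) (exc_image n \<sigma>))"
  proof -
    have "finite (derangements n)"
      by (rule finite_subset[OF _ finite_permutations[of "{1..n}"]]) (auto simp: derangements_def)
    then show ?thesis by (simp add: sum.inter_filter[symmetric] if_distrib cong: if_cong)
  qed
  also have "\<dots> = (\<Sum>(E, F)\<in>Pow {1..n} \<times> Pow {1..n}. q ^ card (E \<inter> F) * type_weight n p q E F * ?g E F)"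
    by (rule sum_derangements)
  also have "\<dots> = (\<Sum>(V, P) | (V, P) \<in> disjoint_pairs n \<and> card V = k. type_weight n p q V P)"
    by (rule sum.mono_neutral_cong_right) (auto simp: disjoint_pairs_def split: if_splits)
  finally show ?thesis .
qed

section \<open>Summation over the double ascents\<close>

theorem corollary9:
  fixes n :: nat and p q t :: "'a::comm_ring_1"
  assumes "n \<ge> 1"
  shows "(\<Sum>\<sigma>\<in>derangements n. p ^ nest n \<sigma> * q ^ cros n \<sigma> * t ^ exc n \<sigma>)
       = (\<Sum>k=0..n div 2. b n k 0 p q * t ^ k * (1 + q * t) ^ (n - 2 * k))"
proof -
  let ?w = "\<lambda>V P. type_weight n p q V P * t ^ card V * (1 + q * t) ^ (n - 2 * card V)"
  \<comment> \<open>Bounding the number of valleys makes the later grouping by \<open>k\<close> land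
    in the index range of the theorem.\<close>
  let ?S = "{z \<in> disjoint_pairs n. card (fst z) \<in> {0..n div 2}}"
  have "(\<Sum>\<sigma>\<in>derangements n. p ^ nest n \<sigma> * q ^ cros n \<sigma> * t ^ exc n \<sigma>)
      = (\<Sum>(E, F)\<in>Pow {1..n} \<times> Pow {1..n}. q ^ card (E \<inter> F) * type_weight n p q E F * t ^ card E)"
    using sum_derangements[where n = n and p = p and q = q and g = "\<lambda>E F. t ^ card E"] by (simp add: exc_def exc_set_def)
  also have "\<dots> = (\<Sum>(V, P)\<in>disjoint_pairs n. \<Sum>A\<in>Pow ({1..n} - V - P).
      q ^ card ((V \<union> A) \<inter> (P \<union> A)) * type_weight n p q (V \<union> A) (P \<union> A) * t ^ card (V \<union> A))"
    by (rule sum_pairs_split)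
  also have "\<dots> = (\<Sum>(V, P)\<in>disjoint_pairs n. ?w V P)"
  proof (intro sum.cong refl, clarify)
    fix V P assume VP: "(V, P) \<in> disjoint_pairs n"
    let ?D = "{1..n} - V - P"
    have sub: "V \<subseteq> {1..n}" "P \<subseteq> {1..n}" "V \<inter> P = {}" using VP by (auto simp: disjoint_pairs_def)
    then have fin: "finite V" "finite P" by (auto intro: finite_subset)
    show "(\<Sum>A\<in>Pow ?D. q ^ card ((V \<union> A) \<inter> (P \<union> A)) * type_weight n p q (V \<union> A) (P \<union> A)
        * t ^ card (V \<union> A)) = ?w V P"
    proof (cases "card V = card P")
      case True
      \<comment> \<open>The type weight is the same for all \<open>A\<close>; each double ascent
        brings a \<open>q\<close> from its extra crossing and a \<open>t\<close> as an
        excedance.\<close>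
      have "(\<Sum>A\<in>Pow ?D. q ^ card ((V \<union> A) \<inter> (P \<union> A)) * type_weight n p q (V \<union> A) (P \<union> A)
          * t ^ card (V \<union> A)) = (\<Sum>A\<in>Pow ?D. type_weight n p q V P * t ^ card V * (q * t) ^ card A)"
      proof (intro sum.cong refl)
        fix A assume "A \<in> Pow ?D"
        then have A: "A \<subseteq> ?D" "finite A" by (auto intro: finite_subset)
        then have "(V \<union> A) \<inter> (P \<union> A) = A" "card (V \<union> A) = card V + card A"
          using sub fin by (auto intro!: card_Un_disjoint)
        then show "q ^ card ((V \<union> A) \<inter> (P \<union> A)) * type_weight n p q (V \<union> A) (P \<union> A)
            * t ^ card (V \<union> A) = type_weight n p q V P * t ^ card V * (q * t) ^ card A"
          using type_weight_Un[OF sub A(1) True, where p = p and q = q]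
          by (simp add: power_add power_mult_distrib mult_ac)
      qed
      moreover have "card ?D = n - 2 * card V"
      proof -
        have "?D = {1..n} - (V \<union> P)" by auto
        then have "card ?D = n - card (V \<union> P)"
          using sub fin by (simp add: card_Diff_subset)
        then show ?thesis using sub fin True by (simp add: card_Un_disjoint)
      qed
      ultimately show ?thesis by (simp add: sum_distrib_left[symmetric] sum_Pow_power_card)
    next
      case False
      \<comment> \<open>Adding \<open>A\<close> to both sets keeps their sizes different, so every
        summand vanishes.\<close>
      have "card (V \<union> A) \<noteq> card (P \<union> A)" if "A \<subseteq> ?D" for A
      proof -
        have "finite A" "V \<inter> A = {}" "P \<inter> A = {}" using that by (auto intro: finite_subset)
        then show ?thesis using False fin by (simp add: card_Un_disjoint)
      qed
      then show ?thesis using False by (simp add: type_weight_eq_0)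
    qed
  qed
  also have "\<dots> = (\<Sum>(V, P)\<in>?S. ?w V P)"
  proof (rule sum.mono_neutral_right[OF finite_disjoint_pairs _ ballI])
    fix z assume "z \<in> disjoint_pairs n - ?S"
    then obtain V P where z: "z = (V, P)" and VP: "(V, P) \<in> disjoint_pairs n" "(V, P) \<notin> ?S"
      by (cases z) auto
    \<comment> \<open>With more than \<open>n div 2\<close> valleys, equally many peaks would not
      fit into \<open>{1..n}\<close>; hence the weight is zero.\<close>
    have "card V + card P \<le> n"
    proof -
      have "V \<union> P \<subseteq> {1..n}" "finite V" "finite P" "V \<inter> P = {}"
        using VP by (auto simp: disjoint_pairs_def intro: finite_subset)
      then show ?thesis using card_mono[of "{1..n}" "V \<union> P"] by (simp add: card_Un_disjoint)
    qed
    then have "card V \<noteq> card P" using VP by auto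
    then show "(case z of (V, P) \<Rightarrow> ?w V P) = 0" by (simp add: z type_weight_eq_0)
  qed auto
  also have "\<dots> = (\<Sum>k=0..n div 2. \<Sum>(V, P) | (V, P) \<in> disjoint_pairs n \<and> card V = k. ?w V P)"
  proof -
    have "{z \<in> ?S. card (fst z) = k} = {(V, P). (V, P) \<in> disjoint_pairs n \<and> card V = k}"
      if "k \<in> {0..n div 2}" for k
      using that by auto
    then show ?thesis
      by (subst sum.group[of ?S "{0..n div 2}" "\<lambda>z. card (fst z)", symmetric])
        (auto simp: finite_disjoint_pairs intro!: sum.cong)
  qed
  also have "\<dots> = (\<Sum>k=0..n div 2. b n k 0 p q * t ^ k * (1 + q * t) ^ (n - 2 * k))"
    unfolding b_eq_type_weight sum_distrib_right
    by (intro sum.cong refl) auto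
  finally show ?thesis .
qed

end
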